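(* For the hypotheses $\Theta_0=\{\theta:\theta\leq \theta_0\}$ and $\Theta_1=\{\theta:\theta>\theta_0\}$, with $\mathrm{P}(\Theta_0),\mathrm{P}(\Theta_1)>0$, let $\varphi$ be a test function, such that $\Theta_0$ is rejected if $\varphi=1$ and accepted if $\varphi=0$. Let $0<\alpha<1$. Under an absolutely continuous prior for $\theta$ and the loss function \[ L_{(2)}(\theta,\varphi) = \begin{cases} 0, & \text{if } \varphi=1-\mathbb{I}_{\Theta_0}(\theta), \\ a, & \text{if } \theta\in\Theta_0 \text{ and }\varphi=1,\\ b, & \text{if } \theta\in\Theta_1 \text{ and }\varphi=0, \end{cases} \] with $a=1-\alpha$ and $b=\alpha$, the Bayes test is to reject $\Theta_0$ if and only if $\theta_0$ is not contained in the lower-bound credible set $\{\theta:\theta\geq q_{\alpha}(\theta|x)\}$, or, equivalently, if and only if $\mathrm{P}(\theta\in\Theta_0|x)\leq\alpha$.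
   Context: The parameter $\theta$ takes values in a parameter space $\Theta\subseteq\mathbb{R}$, and the posterior distribution of $\theta$ given the data $x$ is assumed to be proper and absolutely continuous. $\mathrm{P}(\Theta_0)$ and $\mathrm{P}(\Theta_1)$ are the probabilities of $\Theta_0$ and $\Theta_1$ under the prior, $\mathrm{P}(\cdot|x)$ denotes posterior probability given $x$, and $\mathbb{I}_{\Theta_0}$ is the indicator function of $\Theta_0$. The posterior quantile function of $\theta$ is denoted $q_\alpha(\theta|x)$, and is such that $\mathrm{P}(\theta<q_\alpha(\theta|x)\,|\,x)=\alpha$. The Bayes test is the test function that, given $x$, minimizes the posterior expected loss $\mathrm{E}(L_{(2)}(\theta,\varphi)|x)$.
   Formalization: At ties P(Θ0|x)=α the two criteria can differ (uniform posterior on [0,1], θ0=α=1/2) and the Bayes test is not unique; so both rules are shown to be Bayes tests for every x, while their equivalence and the uniqueness of the Bayes test are claimed only where P(Θ0|x)≠α. *)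

theory Defs
  imports "HOL-Probability.Probability"
begin

text \<open>
  Parameter and data are random variables \<open>T\<close> and \<open>D\<close> on one probability space \<open>M\<close>; the prior
  is the distribution of \<open>T\<close>.  A posterior is a regular conditional distribution of \<open>T\<close> given
  \<open>D\<close>, so no dominating measure is needed for the sampling model.  Properness is the requirement
  that every \<open>post x\<close> is a probability measure.  Concentration on \<open>\<Theta>\<close> for every (not just almost
  every) \<open>x\<close> makes each \<open>post x\<close> a distribution on the parameter space.
\<close>

definition prior :: "'w measure \<Rightarrow> ('w \<Rightarrow> real) \<Rightarrow> real measure" where
  "prior M T = distr M borel T"

definition is_posterior ::
    "'w measure \<Rightarrow> real set \<Rightarrow> ('w \<Rightarrow> real) \<Rightarrow> 'x measure \<Rightarrow> ('w \<Rightarrow> 'x) \<Rightarrow> ('x \<Rightarrow> real measure) \<Rightarrow> bool" where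
  "is_posterior M \<Theta> T X D post \<longleftrightarrow>
     post \<in> X \<rightarrow>\<^sub>M prob_algebra borel \<and>
     (\<forall>A\<in>sets borel. \<forall>B\<in>sets X.
        emeasure M {\<omega> \<in> space M. T \<omega> \<in> A \<and> D \<omega> \<in> B} =
        (\<integral>\<^sup>+x\<in>B. emeasure (post x) A \<partial>distr M X D)) \<and>
     (\<forall>x\<in>space X. AE \<theta> in post x. \<theta> \<in> \<Theta>)"

text \<open>The last branch of the loss is reached only for \<open>\<theta>\<close> outside \<open>\<Theta>0 \<union> \<Theta>1\<close> or \<open>\<phi>\<close> outside \<open>{0, 1}\<close>.\<close>

definition loss2 :: "real set \<Rightarrow> real set \<Rightarrow> real \<Rightarrow> real \<Rightarrow> real \<Rightarrow> real \<Rightarrow> real" where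
  "loss2 \<Theta>0 \<Theta>1 a b \<theta> \<phi> =
     (if \<phi> = 1 - indicator \<Theta>0 \<theta> then 0
      else if \<theta> \<in> \<Theta>0 \<and> \<phi> = 1 then a
      else if \<theta> \<in> \<Theta>1 \<and> \<phi> = 0 then b
      else 0)"

definition posterior_expected_loss ::
    "('x \<Rightarrow> real measure) \<Rightarrow> (real \<Rightarrow> real \<Rightarrow> real) \<Rightarrow> 'x \<Rightarrow> real \<Rightarrow> real" where
  "posterior_expected_loss post L x d = (LINT \<theta>|post x. L \<theta> d)"

definition test_function :: "'x measure \<Rightarrow> ('x \<Rightarrow> real) \<Rightarrow> bool" where
  "test_function X \<phi> \<longleftrightarrow> (\<forall>x\<in>space X. \<phi> x \<in> {0, 1})"

text \<open>
  The minimization is carried out separately for each \<open>x\<close>.  A Bayes test need not be unique: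
  where both decisions have the same posterior expected loss, either is allowed.  With loss
  \<open>1 - \<alpha>\<close> for false rejection and \<open>\<alpha>\<close> for false acceptance this happens exactly where the
  posterior probability of \<open>\<Theta>0\<close> equals \<open>\<alpha>\<close>.
\<close>

definition bayes_test ::
    "'x measure \<Rightarrow> ('x \<Rightarrow> real measure) \<Rightarrow> (real \<Rightarrow> real \<Rightarrow> real) \<Rightarrow> ('x \<Rightarrow> real) \<Rightarrow> bool" where
  "bayes_test X post L \<phi> \<longleftrightarrow>
     test_function X \<phi> \<and>
     (\<forall>\<psi>. test_function X \<psi> \<longrightarrow>
        (\<forall>x\<in>space X. posterior_expected_loss post L x (\<phi> x) \<le> posterior_expected_loss post L x (\<psi> x)))"

text \<open>
  Any solution of the quantile equation is admitted, also where the posterior distribution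
  function has a plateau at level \<open>\<alpha>\<close>.
\<close>

definition posterior_quantile ::
    "'x measure \<Rightarrow> ('x \<Rightarrow> real measure) \<Rightarrow> real \<Rightarrow> ('x \<Rightarrow> real) \<Rightarrow> bool" where
  "posterior_quantile X post \<alpha> q \<longleftrightarrow> (\<forall>x\<in>space X. measure (post x) {\<theta>. \<theta> < q x} = \<alpha>)"

definition lower_bound_credible_set :: "('x \<Rightarrow> real) \<Rightarrow> 'x \<Rightarrow> real set" where
  "lower_bound_credible_set q x = {\<theta>. \<theta> \<ge> q x}"

end

theory Submission
  imports Defs
begin

text \<open>
  With only two decisions available, a test minimizes the posterior expected loss at \<open>x\<close> exactly when
  its decision there costs no more than the opposite one.  Write \<open>p\<close> for the posterior probability of
  \<open>\<Theta>0\<close>.  Rejection costs \<open>a * p\<close> and acceptance costs \<open>b * (1 - p)\<close>; for \<open>a = 1 - \<alpha>\<close> and \<open>b = \<alpha>\<close> the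
  difference of the two is \<open>p - \<alpha>\<close>.  Hence rejection is optimal iff \<open>p \<le> \<alpha>\<close>, acceptance iff \<open>p \<ge> \<alpha>\<close>,
  and the Bayes tests are the tests that reject where \<open>p < \<alpha>\<close> and accept where \<open>p > \<alpha>\<close>
  (\<open>bayes_test_loss2_iff\<close>).

  The credible set enters through monotonicity of the posterior distribution function: \<open>p\<close> is its value
  at \<open>\<theta>0\<close>, and \<open>\<alpha>\<close> is the mass to the left of \<open>q x\<close>.  So \<open>\<theta>0 < q x\<close> forces \<open>p \<le> \<alpha>\<close> and
  \<open>q x \<le> \<theta>0\<close> forces \<open>p \<ge> \<alpha>\<close> (\<open>cdf_compare_quantile\<close>).  The two rejection rules therefore agree
  wherever \<open>p \<noteq> \<alpha>\<close>.  Where \<open>p = \<alpha>\<close> they may differ, for example when \<open>\<theta>0\<close> equals the quantile, but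
  there both decisions are optimal.
\<close>

lemma bayes_test_iff_opposite_decision:
  "bayes_test X post L \<phi> \<longleftrightarrow>
     test_function X \<phi> \<and>
     (\<forall>x\<in>space X. posterior_expected_loss post L x (\<phi> x)
                    \<le> posterior_expected_loss post L x (1 - \<phi> x))"
    (is "_ \<longleftrightarrow> _ \<and> (\<forall>x\<in>_. ?R x (\<phi> x) \<le> _)")
proof (intro iffI conjI ballI)
  assume *: "bayes_test X post L \<phi>"
  then show "test_function X \<phi>" by (simp add: bayes_test_def)
  fix x assume "x \<in> space X"
  have "test_function X (\<lambda>x. 1 - \<phi> x)"
    using * by (auto simp: bayes_test_def test_function_def)
  with * \<open>x \<in> space X\<close> show "?R x (\<phi> x) \<le> ?R x (1 - \<phi> x)"
    unfolding bayes_test_def by blast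
next
  assume *: "test_function X \<phi> \<and> (\<forall>x\<in>space X. ?R x (\<phi> x) \<le> ?R x (1 - \<phi> x))"
  have "?R x (\<phi> x) \<le> ?R x (\<psi> x)" if "test_function X \<psi>" "x \<in> space X" for \<psi> x
  proof -
    have "\<psi> x = \<phi> x \<or> \<psi> x = 1 - \<phi> x"
      using * that by (fastforce simp: test_function_def)
    then show ?thesis using * that(2) by (elim disjE) simp_all
  qed
  with * show "bayes_test X post L \<phi>" by (simp add: bayes_test_def)
qed

lemma loss2_reject: "loss2 \<Theta>0 \<Theta>1 a b \<theta> 1 = a * indicator \<Theta>0 \<theta>"
  by (simp add: loss2_def indicator_def)

lemma loss2_accept:
  assumes "\<theta> \<in> \<Theta>0 \<union> \<Theta>1"
  shows "loss2 \<Theta>0 \<Theta>1 a b \<theta> 0 = b * (1 - indicator \<Theta>0 \<theta>)"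
  using assms by (auto simp: loss2_def indicator_def)

lemma posterior_expected_loss2_reject:
  assumes "\<Theta>0 \<in> sets (post x)"
  shows "posterior_expected_loss post (loss2 \<Theta>0 \<Theta>1 a b) x 1 = a * measure (post x) \<Theta>0"
  using sets.Int_space_eq2[OF assms] by (simp add: posterior_expected_loss_def loss2_reject)

lemma posterior_expected_loss2_accept:
  assumes "prob_space (post x)" and [measurable]: "\<Theta>0 \<in> sets (post x)" "\<Theta>1 \<in> sets (post x)"
    and concentrated: "AE \<theta> in post x. \<theta> \<in> \<Theta>0 \<union> \<Theta>1"
  shows "posterior_expected_loss post (loss2 \<Theta>0 \<Theta>1 a b) x 0 = b * (1 - measure (post x) \<Theta>0)"
proof -
  interpret prob_space "post x" by fact
  have "posterior_expected_loss post (loss2 \<Theta>0 \<Theta>1 a b) x 0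
      = (LINT \<theta>|post x. b * (1 - indicator \<Theta>0 \<theta>))"
    unfolding posterior_expected_loss_def
  proof (rule integral_cong_AE)
    show "(\<lambda>\<theta>. loss2 \<Theta>0 \<Theta>1 a b \<theta> 0) \<in> borel_measurable (post x)"
      unfolding loss2_def by measurable
    show "AE \<theta> in post x. loss2 \<Theta>0 \<Theta>1 a b \<theta> 0 = b * (1 - indicator \<Theta>0 \<theta>)"
      using concentrated by eventually_elim (rule loss2_accept)
  qed measurable
  also have "\<dots> = b * (1 - prob \<Theta>0)"
    by (simp add: Bochner_Integration.integral_diff prob_space less_top[symmetric])
  finally show ?thesis .
qed

text \<open>
  A tie \<open>p = \<alpha>\<close> leaves the decision free, so the rejection rule is imposed only off the tie.  The weights
  \<open>1 - \<alpha>\<close> and \<open>\<alpha>\<close> add up to one, and this puts the threshold \<open>b / (a + b)\<close> for \<open>p\<close> at \<open>\<alpha>\<close>.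
\<close>

lemma bayes_test_loss2_iff:
  assumes "\<And>x. x \<in> space X \<Longrightarrow> prob_space (post x)"
    and "\<And>x. x \<in> space X \<Longrightarrow> \<Theta>0 \<in> sets (post x)"
    and "\<And>x. x \<in> space X \<Longrightarrow> \<Theta>1 \<in> sets (post x)"
    and "\<And>x. x \<in> space X \<Longrightarrow> AE \<theta> in post x. \<theta> \<in> \<Theta>0 \<union> \<Theta>1"
  shows "bayes_test X post (loss2 \<Theta>0 \<Theta>1 (1 - \<alpha>) \<alpha>) \<phi> \<longleftrightarrow>
     test_function X \<phi> \<and>
     (\<forall>x\<in>space X. measure (post x) \<Theta>0 \<noteq> \<alpha> \<longrightarrow> (\<phi> x = 1 \<longleftrightarrow> measure (post x) \<Theta>0 \<le> \<alpha>))"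
proof -
  let ?R = "posterior_expected_loss post (loss2 \<Theta>0 \<Theta>1 (1 - \<alpha>) \<alpha>)"
  have "?R x (\<phi> x) \<le> ?R x (1 - \<phi> x) \<longleftrightarrow>
      (measure (post x) \<Theta>0 \<noteq> \<alpha> \<longrightarrow> (\<phi> x = 1 \<longleftrightarrow> measure (post x) \<Theta>0 \<le> \<alpha>))"
    if "test_function X \<phi>" and x: "x \<in> space X" for x
  proof -
    define p where "p = measure (post x) \<Theta>0"
    have reject: "?R x 1 = (1 - \<alpha>) * p"
      unfolding p_def by (intro posterior_expected_loss2_reject assms x)
    have accept: "?R x 0 = \<alpha> * (1 - p)"
      unfolding p_def by (intro posterior_expected_loss2_accept assms x)
    have "?R x 1 - ?R x 0 = p - \<alpha>"
      by (simp add: reject accept algebra_simps)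
    moreover have "\<phi> x = 0 \<or> \<phi> x = 1"
      using that by (auto simp: test_function_def)
    ultimately show ?thesis
      unfolding p_def[symmetric] by auto
  qed
  then show ?thesis
    unfolding bayes_test_iff_opposite_decision by blast
qed

text \<open>
  Both inequalities come from inclusions between half-lines.  Neither can be made strict: on a plateau
  of the distribution function \<open>t\<close> and \<open>q\<close> may be in either order while the two masses are equal.
\<close>

lemma cdf_compare_quantile:
  fixes M :: "real measure" and t q :: real
  assumes "finite_measure M" and [simp]: "sets M = sets borel"
  shows "t < q \<Longrightarrow> measure M {..t} \<le> measure M {..<q}"
    and "q \<le> t \<Longrightarrow> measure M {..<q} \<le> measure M {..t}"
  using assms(1) by (auto intro!: finite_measure.finite_measure_mono)

lemma is_posteriorD:
  assumes "is_posterior M \<Theta> T X D post" and "x \<in> space X"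
  shows "prob_space (post x)" and "sets (post x) = sets borel" and "AE \<theta> in post x. \<theta> \<in> \<Theta>"
proof -
  have "post x \<in> space (prob_algebra borel)"
    using assms by (auto simp: is_posterior_def dest: measurable_space)
  then show "prob_space (post x)" "sets (post x) = sets borel"
    by (auto simp: space_prob_algebra)
  show "AE \<theta> in post x. \<theta> \<in> \<Theta>"
    using assms by (auto simp: is_posterior_def)
qed

theorem theorem2:
  fixes M :: "'w measure" and X :: "'x measure"
    and T :: "'w \<Rightarrow> real" and D :: "'w \<Rightarrow> 'x"
    and \<Theta> \<Theta>0 \<Theta>1 :: "real set" and \<theta>0 \<alpha> a b :: real
    and post :: "'x \<Rightarrow> real measure" and q :: "'x \<Rightarrow> real"
  assumes "prob_space M"
    and "\<Theta> \<in> sets borel"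
    and "T \<in> M \<rightarrow>\<^sub>M borel" and "\<And>\<omega>. \<omega> \<in> space M \<Longrightarrow> T \<omega> \<in> \<Theta>"
    and "D \<in> M \<rightarrow>\<^sub>M X"
    and "absolutely_continuous lborel (prior M T)"
    and "is_posterior M \<Theta> T X D post"
    and "\<And>x. x \<in> space X \<Longrightarrow> absolutely_continuous lborel (post x)"
    and "\<Theta>0 = {\<theta> \<in> \<Theta>. \<theta> \<le> \<theta>0}" and "\<Theta>1 = {\<theta> \<in> \<Theta>. \<theta> > \<theta>0}"
    and "measure (prior M T) \<Theta>0 > 0" and "measure (prior M T) \<Theta>1 > 0"
    and "0 < \<alpha>" and "\<alpha> < 1" and "a = 1 - \<alpha>" and "b = \<alpha>"
    and "posterior_quantile X post \<alpha> q"
  shows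
    "bayes_test X post (loss2 \<Theta>0 \<Theta>1 a b)
       (\<lambda>x. if \<theta>0 \<notin> lower_bound_credible_set q x then 1 else 0) \<and>
     bayes_test X post (loss2 \<Theta>0 \<Theta>1 a b)
       (\<lambda>x. if measure (post x) \<Theta>0 \<le> \<alpha> then 1 else 0) \<and>
     (\<forall>\<phi>. test_function X \<phi> \<longrightarrow>
       (bayes_test X post (loss2 \<Theta>0 \<Theta>1 a b) \<phi> \<longleftrightarrow>
          (\<forall>x\<in>space X. measure (post x) \<Theta>0 \<noteq> \<alpha> \<longrightarrow>
             (\<phi> x = 1 \<longleftrightarrow> \<theta>0 \<notin> lower_bound_credible_set q x))) \<and>
       (bayes_test X post (loss2 \<Theta>0 \<Theta>1 a b) \<phi> \<longleftrightarrow>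
          (\<forall>x\<in>space X. measure (post x) \<Theta>0 \<noteq> \<alpha> \<longrightarrow>
             (\<phi> x = 1 \<longleftrightarrow> measure (post x) \<Theta>0 \<le> \<alpha>)))) \<and>
     (\<forall>x\<in>space X.
       (\<theta>0 \<notin> lower_bound_credible_set q x \<longrightarrow> measure (post x) \<Theta>0 \<le> \<alpha>) \<and>
       (measure (post x) \<Theta>0 \<noteq> \<alpha> \<longrightarrow>
          (\<theta>0 \<notin> lower_bound_credible_set q x \<longleftrightarrow> measure (post x) \<Theta>0 \<le> \<alpha>)))"
proof -
  define p where "p x = measure (post x) \<Theta>0" for x
  have [measurable]: "\<Theta> \<in> sets borel" by fact
  note post = is_posteriorD[OF \<open>is_posterior M \<Theta> T X D post\<close>]
  have \<Theta>0_borel: "\<Theta>0 \<in> sets borel" and \<Theta>1_borel: "\<Theta>1 \<in> sets borel"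
    unfolding \<open>\<Theta>0 = _\<close> \<open>\<Theta>1 = _\<close> by measurable
  have concentrated: "AE \<theta> in post x. \<theta> \<in> \<Theta>0 \<union> \<Theta>1" if "x \<in> space X" for x
    using post(3)[OF that] by eventually_elim (auto simp: \<open>\<Theta>0 = _\<close> \<open>\<Theta>1 = _\<close>)
  have bayes: "bayes_test X post (loss2 \<Theta>0 \<Theta>1 a b) \<phi> \<longleftrightarrow>
      test_function X \<phi> \<and> (\<forall>x\<in>space X. p x \<noteq> \<alpha> \<longrightarrow> (\<phi> x = 1 \<longleftrightarrow> p x \<le> \<alpha>))" for \<phi>
    unfolding \<open>a = _\<close> \<open>b = _\<close> p_def
    by (rule bayes_test_loss2_iff) (simp_all add: post(1,2) \<Theta>0_borel \<Theta>1_borel concentrated[simplified])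
  have rules: "(\<theta>0 < q x \<longrightarrow> p x \<le> \<alpha>) \<and> (q x \<le> \<theta>0 \<longrightarrow> \<alpha> \<le> p x)" if x: "x \<in> space X" for x
  proof -
    interpret prob_space "post x" by (rule post(1)[OF x])
    have "p x = measure (post x) {..\<theta>0}"
      unfolding p_def
    proof (rule finite_measure_eq_AE)
      show "AE \<theta> in post x. \<theta> \<in> \<Theta>0 \<longleftrightarrow> \<theta> \<in> {..\<theta>0}"
        using post(3)[OF x] by eventually_elim (simp add: \<open>\<Theta>0 = _\<close>)
    qed (simp_all add: post(2)[OF x] \<Theta>0_borel)
    moreover have "measure (post x) {..<q x} = \<alpha>"
      using \<open>posterior_quantile X post \<alpha> q\<close> x by (simp add: posterior_quantile_def lessThan_def)
    ultimately show ?thesis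
      using cdf_compare_quantile[OF finite_measure_axioms post(2)[OF x], where t = \<theta>0 and q = "q x"] by simp
  qed
  have rejects: "\<theta>0 \<notin> lower_bound_credible_set q x \<longleftrightarrow> \<theta>0 < q x" for x
    by (auto simp: lower_bound_credible_set_def)
  have agree: "\<theta>0 < q x \<longleftrightarrow> p x \<le> \<alpha>" if "x \<in> space X" "p x \<noteq> \<alpha>" for x
    using rules[OF that(1)] that(2) by linarith
  show ?thesis
    unfolding bayes rejects p_def[symmetric]
    using agree rules by (auto simp: test_function_def)
qed

end
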